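(* Let $(H;\langle\cdot,\cdot\rangle)$ be an inner product space over $\mathbb{K}$ and $x,y,e\in H$ with $\|e\|=1$. Suppose also that $a,A,b,B\in\mathbb{K}$ are such that $A\ne\pm a$ and $B\neq\pm b$. If either $$\operatorname{Re}\langle Ae-x,\,x-ae\rangle\ge0,\qquad \operatorname{Re}\langle Be-y,\,y-be\rangle\ge0,$$ or, equivalently, $$\left\|x-\frac{a+A}{2}e\right\|\le\frac12|A-a|,\qquad \left\|y-\frac{b+B}{2}e\right\|\le\frac12|B-b|$$ holds, then $$|\langle x,y\rangle-\langle x,e\rangle\langle e,y\rangle| \le \frac12\cdot\frac{|A-a||B-b|}{\sqrt{|A+a||B+b|}}\sqrt{\frac18\cdot\frac{|A-a|^2}{|A+a|}+|\langle x,e\rangle|}\cdot\sqrt{\frac18\cdot\frac{|B-b|^2}{|B+b|}+|\langle y,e\rangle|} .$$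
   Context: $\mathbb{K}$ denotes $\mathbb{R}$ or $\mathbb{C}$. Inner products are linear in the first argument and conjugate-linear in the second, and $\|x\|=\langle x,x\rangle^{1/2}$. *)

theory Defs
  imports "HOL-Analysis.Inner_Product"
begin

text \<open>
  The scalar field is the real or the complex field: a type of this class comes with a
  norm-preserving real-algebra embedding into the complex numbers whose image is either
  the reals or everything.  Real parts and conjugates of scalars are taken through this embedding.
\<close>

class real_or_complex = real_normed_field +
  fixes to_complex :: "'a \<Rightarrow> complex"
  assumes to_complex_add: "to_complex (x + y) = to_complex x + to_complex y"
    and to_complex_mult: "to_complex (x * y) = to_complex x * to_complex y"
    and to_complex_scaleR: "to_complex (scaleR r x) = scaleR r (to_complex x)"
    and norm_to_complex: "cmod (to_complex x) = norm x"
    and range_to_complex: "range to_complex = \<real> \<or> range to_complex = UNIV"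

instantiation real :: real_or_complex
begin

definition to_complex_real :: "real \<Rightarrow> complex"
  where "to_complex_real = complex_of_real"

instance
  by standard (auto simp: to_complex_real_def Reals_def scaleR_conv_of_real)

end

instantiation complex :: real_or_complex
begin

definition to_complex_complex :: "complex \<Rightarrow> complex"
  where "to_complex_complex z = z"

instance
  by standard (auto simp: to_complex_complex_def)

end

text \<open>
  Inner products are linear in the first argument and conjugate-linear in the second; the latter
  follows from linearity and conjugate symmetry.  The value \<open>ip x x\<close> is real by conjugate symmetry,
  so positivity is expressed by its real part.
\<close>

locale inner_product_space = vector_space scale
  for scale :: "'k::real_or_complex \<Rightarrow> 'h::ab_group_add \<Rightarrow> 'h" +
  fixes ip :: "'h \<Rightarrow> 'h \<Rightarrow> 'k"
  assumes ip_add_left: "ip (x + y) z = ip x z + ip y z"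
    and ip_scale_left: "ip (scale c x) y = c * ip x y"
    and ip_conj_sym: "to_complex (ip y x) = cnj (to_complex (ip x y))"
    and ip_pos: "x \<noteq> 0 \<Longrightarrow> 0 < Re (to_complex (ip x x))"

definition ip_norm :: "('h \<Rightarrow> 'h \<Rightarrow> 'k::real_or_complex) \<Rightarrow> 'h \<Rightarrow> real"
  where "ip_norm ip x = sqrt (Re (to_complex (ip x x)))"

lemma inner_product_space_real_inner:
  "inner_product_space scaleR (inner :: 'a::real_inner \<Rightarrow> 'a \<Rightarrow> real)"
  by unfold_locales
    (auto simp: to_complex_real_def inner_add_left inner_add_right inner_commute scaleR_add_right scaleR_add_left)

lemma ip_norm_real_inner: "ip_norm (inner :: 'a::real_inner \<Rightarrow> 'a \<Rightarrow> real) x = norm x"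
  by (simp add: ip_norm_def to_complex_real_def norm_eq_sqrt_inner)

lemma inner_product_space_complex:
  "inner_product_space (*) (\<lambda>z w :: complex. z * cnj w)"
proof unfold_locales
  fix z :: complex
  assume "z \<noteq> 0"
  then show "0 < Re (to_complex (z * cnj z))"
    unfolding to_complex_complex_def complex_mult_cnj
    by (metis Re_complex_of_real complex_neq_0)
qed (auto simp: to_complex_complex_def algebra_simps)

end

theory Submission
  imports Defs
begin

text \<open>
  Put \<open>c = (a + A) / 2\<close>, \<open>r = \<bar>A - a\<bar> / 2\<close> and \<open>p = \<langle>x, e\<rangle>\<close>.  The equivalence of the hypotheses is
  \<open>Re \<langle>v - u, v + u\<rangle> = \<parallel>v\<parallel>\<^sup>2 - \<parallel>u\<parallel>\<^sup>2\<close> for \<open>v = ((A - a) / 2) e\<close> and \<open>u = x - c e\<close>.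
  For the inequality, Cauchy--Schwarz applied to \<open>x - p e\<close> and the corresponding vector of \<open>y\<close>
  reduces everything to bounding \<open>\<parallel>x - p e\<parallel>\<^sup>2\<close>.  By Pythagoras
  \<open>\<parallel>x - p e\<parallel>\<^sup>2 = \<parallel>x - c e\<parallel>\<^sup>2 - \<bar>p - c\<bar>\<^sup>2 \<le> r\<^sup>2 - (\<bar>p\<bar> - \<bar>c\<bar>)\<^sup>2\<close>, and this is at most
  \<open>r\<^sup>4 / (4 \<bar>c\<bar>\<^sup>2) + r\<^sup>2 \<bar>p\<bar> / \<bar>c\<bar>\<close>, the difference being the square of
  \<open>r\<^sup>2 / (2 \<bar>c\<bar>) + \<bar>p\<bar> - \<bar>c\<bar>\<close>.
\<close>

lemma to_complex_0 [simp]: "to_complex 0 = 0"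
  using norm_to_complex[of 0] by simp

text \<open>The image of 1 is idempotent, and having norm 1 it cannot be 0.\<close>

lemma to_complex_1 [simp]: "to_complex (1 :: 'a::real_or_complex) = 1"
  using to_complex_mult[of "1 :: 'a" 1] norm_to_complex[of "1 :: 'a"] by auto

lemma to_complex_minus: "to_complex (- x) = - to_complex x"
  using to_complex_add[of x "- x"] by (simp add: eq_neg_iff_add_eq_0 add.commute)

lemma to_complex_diff: "to_complex (x - y) = to_complex x - to_complex y"
  using to_complex_add[of x "- y"] by (simp add: to_complex_minus)

text \<open>Norm preservation makes the embedding injective, so identities between scalars can be
  checked in the complex numbers.\<close>

lemma to_complex_eq_iff [simp]: "to_complex x = to_complex y \<longleftrightarrow> x = y"
proof -
  have "to_complex x = to_complex y \<longleftrightarrow> cmod (to_complex (x - y)) = 0"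
    by (simp add: to_complex_diff)
  then show ?thesis
    by (simp add: norm_to_complex)
qed

context inner_product_space
begin

lemma ip_zero_left [simp]: "ip 0 y = 0"
  using ip_add_left[of 0 0 y] by simp

lemma ip_minus_left: "ip (- x) y = - ip x y"
  using ip_add_left[of x "- x" y] by (simp add: eq_neg_iff_add_eq_0 add.commute)

lemma ip_diff_left: "ip (x - y) z = ip x z - ip y z"
  using ip_add_left[of x "- y" z] by (simp add: ip_minus_left)

text \<open>Conjugate symmetry is available only after embedding, so the laws for the second
  argument are first derived through \<open>to_complex\<close>.\<close>

lemma to_complex_ip_add_right:
  "to_complex (ip x (y + z)) = to_complex (ip x y) + to_complex (ip x z)"
  by (simp add: ip_conj_sym[of x] ip_add_left to_complex_add)

lemma to_complex_ip_diff_right: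
  "to_complex (ip x (y - z)) = to_complex (ip x y) - to_complex (ip x z)"
  by (simp add: ip_conj_sym[of x] ip_diff_left to_complex_diff)

lemma to_complex_ip_scale_right:
  "to_complex (ip x (scale c y)) = cnj (to_complex c) * to_complex (ip x y)"
  by (simp add: ip_conj_sym[of x] ip_scale_left to_complex_mult)

lemma ip_diff_right: "ip x (y - z) = ip x y - ip x z"
proof -
  have "to_complex (ip x (y - z)) = to_complex (ip x y - ip x z)"
    by (simp add: to_complex_ip_diff_right to_complex_diff)
  then show ?thesis
    by simp
qed

lemma ip_eq_0_sym: "ip x y = 0 \<Longrightarrow> ip y x = 0"
  using ip_conj_sym[of y x] to_complex_eq_iff[of "ip y x" 0] by simp

lemma ip_scale_right_eq_0: "ip x y = 0 \<Longrightarrow> ip x (scale c y) = 0"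
  using to_complex_ip_scale_right[of x c y] to_complex_eq_iff[of "ip x (scale c y)" 0] by simp

lemma Re_ip_sym: "Re (to_complex (ip y x)) = Re (to_complex (ip x y))"
  by (simp add: ip_conj_sym[of y])

lemma Re_ip_self_nonneg: "0 \<le> Re (to_complex (ip x x))"
  using ip_pos[of x] by (cases "x = 0") auto

lemma ip_norm_nonneg [simp]: "0 \<le> ip_norm ip x"
  by (simp add: ip_norm_def Re_ip_self_nonneg)

lemma ip_norm_square: "(ip_norm ip x)\<^sup>2 = Re (to_complex (ip x x))"
  by (simp add: ip_norm_def Re_ip_self_nonneg)

lemma to_complex_ip_self: "to_complex (ip x x) = complex_of_real ((ip_norm ip x)\<^sup>2)"
  using ip_conj_sym[of x x] by (simp add: ip_norm_square complex_eq_iff)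

lemma ip_norm_scale: "ip_norm ip (scale c x) = norm c * ip_norm ip x"
proof -
  have "to_complex (ip (scale c x) (scale c x))
      = (to_complex c * cnj (to_complex c)) * to_complex (ip x x)"
    by (simp add: ip_scale_left to_complex_mult to_complex_ip_scale_right)
  also have "\<dots> = complex_of_real ((norm c * ip_norm ip x)\<^sup>2)"
    by (simp only: complex_norm_square[symmetric] to_complex_ip_self norm_to_complex
        power_mult_distrib of_real_mult)
  finally have "(ip_norm ip (scale c x))\<^sup>2 = (norm c * ip_norm ip x)\<^sup>2"
    by (simp only: ip_norm_square Re_complex_of_real)
  then show ?thesis
    by (simp add: power2_eq_iff_nonneg)
qed

lemma ip_norm_pythagoras:
  assumes "ip x y = 0"
  shows "(ip_norm ip (x + y))\<^sup>2 = (ip_norm ip x)\<^sup>2 + (ip_norm ip y)\<^sup>2"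
  using assms ip_eq_0_sym[OF assms]
  by (simp add: ip_norm_square ip_add_left to_complex_add to_complex_ip_add_right)

text \<open>The cross terms \<open>ip v u\<close> and \<open>ip u v\<close> occur with opposite
  signs and are conjugate, so their real parts cancel.\<close>

lemma Re_ip_diff_add:
  "Re (to_complex (ip (v - u) (v + u))) = (ip_norm ip v)\<^sup>2 - (ip_norm ip u)\<^sup>2"
  using Re_ip_sym[of u v]
  by (simp add: ip_norm_square ip_diff_left to_complex_diff to_complex_ip_add_right)

lemma norm_ip_le: "norm (ip x y) \<le> ip_norm ip x * ip_norm ip y"
proof (cases "y = 0")
  case True
  then have "ip x y = 0"
    using ip_eq_0_sym[of y x] by simp
  then show ?thesis
    by simp
next
  case False
  \<comment> \<open>\<open>z\<close> is the component of \<open>x\<close> orthogonal to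
    \<open>y\<close>, multiplied by \<open>ip y y\<close> to avoid division; Cauchy--Schwarz is the
    nonnegativity of \<open>ip z z\<close>.\<close>
  define z where "z = scale (ip y y) x - scale (ip x y) y"
  have "ip z y = 0"
    by (simp add: z_def ip_diff_left ip_scale_left)
  then have "to_complex (ip z z) = cnj (to_complex (ip y y)) * to_complex (ip z x)"
    unfolding z_def[symmetric]
    \<comment> \<open>Only the second argument is expanded: the first stays \<open>z\<close>, so
      that \<open>ip z y = 0\<close> removes the \<open>y\<close> term.\<close>
    by (subst (2) z_def) (simp add: to_complex_ip_diff_right to_complex_ip_scale_right)
  also have "to_complex (ip z x) = to_complex (ip y y) * to_complex (ip x x)
      - to_complex (ip x y) * cnj (to_complex (ip x y))"
    by (simp add: z_def ip_diff_left ip_scale_left to_complex_diff to_complex_mult ip_conj_sym[of y x])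
  also have "\<dots> = complex_of_real ((ip_norm ip y)\<^sup>2 * (ip_norm ip x)\<^sup>2 - (norm (ip x y))\<^sup>2)"
    by (simp only: complex_norm_square[symmetric] to_complex_ip_self norm_to_complex
        of_real_mult of_real_diff)
  finally have "Re (to_complex (ip z z))
      = (ip_norm ip y)\<^sup>2 * ((ip_norm ip y)\<^sup>2 * (ip_norm ip x)\<^sup>2 - (norm (ip x y))\<^sup>2)"
    by (simp only: to_complex_ip_self complex_cnj_complex_of_real of_real_mult[symmetric]
        Re_complex_of_real)
  then have "0 \<le> (ip_norm ip y)\<^sup>2 * ((ip_norm ip y)\<^sup>2 * (ip_norm ip x)\<^sup>2 - (norm (ip x y))\<^sup>2)"
    using Re_ip_self_nonneg[of z] by simp
  moreover have "0 < (ip_norm ip y)\<^sup>2"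
    using ip_pos[OF False] by (simp add: ip_norm_square)
  ultimately have "(norm (ip x y))\<^sup>2 \<le> (ip_norm ip x * ip_norm ip y)\<^sup>2"
    by (simp add: zero_le_mult_iff power_mult_distrib mult.commute)
  then show ?thesis
    by (rule power2_le_imp_le) simp
qed

lemma Re_ip_ge_0_iff_norm_le:
  assumes "ip_norm ip e = 1"
  shows "0 \<le> Re (to_complex (ip (scale A e - x) (x - scale a e)))
    \<longleftrightarrow> ip_norm ip (x - scale ((a + A) / 2) e) \<le> 1 / 2 * norm (A - a)"
proof -
  \<comment> \<open>\<open>v\<close> is half of the segment from \<open>scale a e\<close> to
    \<open>scale A e\<close>, and \<open>u\<close> is the displacement of \<open>x\<close> from its
    midpoint.\<close>
  define u v where "u = x - scale ((a + A) / 2) e" and "v = scale ((A - a) / 2) e"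
  have "A = (A - a) / 2 + (a + A) / 2" "a = (a + A) / 2 - (A - a) / 2"
    by (simp_all add: field_simps)
  then have "scale A e = v + scale ((a + A) / 2) e" "scale a e = scale ((a + A) / 2) e - v"
    unfolding v_def by (metis scale_left_distrib, metis scale_left_diff_distrib)
  then have "scale A e - x = v - u" "x - scale a e = v + u"
    by (simp_all add: u_def)
  then have "Re (to_complex (ip (scale A e - x) (x - scale a e)))
      = (ip_norm ip v)\<^sup>2 - (ip_norm ip u)\<^sup>2"
    by (simp add: Re_ip_diff_add)
  moreover have "ip_norm ip v = 1 / 2 * norm (A - a)"
    using assms by (simp add: v_def ip_norm_scale norm_divide)
  ultimately show ?thesis
    unfolding u_def[symmetric] by (simp add: power2_le_iff_abs_le)
qed

lemma ip_diff_projection: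
  assumes "ip_norm ip e = 1"
  shows "ip (x - scale (ip x e) e) e = 0"
proof -
  have "ip e e = 1"
    using to_complex_ip_self[of e] to_complex_eq_iff[of "ip e e" 1] by (simp add: assms)
  then show ?thesis
    by (simp add: ip_diff_left ip_scale_left)
qed

lemma ip_norm_diff_projection_square_le:
  assumes e: "ip_norm ip e = 1" and "A \<noteq> - a"
    and x: "ip_norm ip (x - scale ((a + A) / 2) e) \<le> 1 / 2 * norm (A - a)"
  shows "(ip_norm ip (x - scale (ip x e) e))\<^sup>2
    \<le> 1 / 2 * ((norm (A - a))\<^sup>2 / norm (A + a))
       * (1 / 8 * ((norm (A - a))\<^sup>2 / norm (A + a)) + norm (ip x e))"
proof -
  define c p where "c = (a + A) / 2" and "p = ip x e"
  define D s where "D = norm (A - a)" and "s = norm (A + a)"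
  have "s > 0"
    using assms(2) by (simp add: s_def add_eq_0_iff2)
  have s: "norm c = s / 2"
    by (simp add: c_def s_def norm_divide add.commute)
  have "x - scale c e = (x - scale p e) + scale (p - c) e"
    by (simp add: scale_left_diff_distrib)
  moreover have "ip (x - scale p e) (scale (p - c) e) = 0"
    unfolding p_def by (intro ip_scale_right_eq_0 ip_diff_projection e)
  ultimately have "(ip_norm ip (x - scale c e))\<^sup>2
      = (ip_norm ip (x - scale p e))\<^sup>2 + (norm (p - c))\<^sup>2"
    by (simp only: ip_norm_pythagoras) (simp add: ip_norm_scale e)
  moreover have "(ip_norm ip (x - scale c e))\<^sup>2 \<le> (D / 2)\<^sup>2"
    using x by (intro power_mono) (auto simp: c_def D_def)
  \<comment> \<open>Reverse triangle inequality, with \<open>s / 2\<close> standing for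
    \<open>norm c\<close>.\<close>
  moreover have "(norm p - s / 2)\<^sup>2 \<le> (norm (p - c))\<^sup>2"
    unfolding s[symmetric] by (rule power2_le_iff_abs_le[THEN iffD2]) (auto intro: norm_triangle_ineq3)
  ultimately have "(ip_norm ip (x - scale p e))\<^sup>2 \<le> (D / 2)\<^sup>2 - (norm p - s / 2)\<^sup>2"
    by linarith
  \<comment> \<open>Completing the square: the cross term of \<open>D\<^sup>2 / (4 * s)\<close> with
    \<open>norm p - s / 2\<close> supplies both \<open>(D / 2)\<^sup>2\<close> and the term linear
    in \<open>norm p\<close>.\<close>
  also have "\<dots> = 1 / 2 * (D\<^sup>2 / s) * (1 / 8 * (D\<^sup>2 / s) + norm p)
      - (D\<^sup>2 / (4 * s) + norm p - s / 2)\<^sup>2"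
    using \<open>s > 0\<close> by (simp add: field_simps power2_eq_square)
  also have "\<dots> \<le> 1 / 2 * (D\<^sup>2 / s) * (1 / 8 * (D\<^sup>2 / s) + norm p)"
    by simp
  finally show ?thesis
    by (simp only: D_def s_def p_def)
qed

text \<open>The projected \<open>x\<close> is orthogonal to \<open>e\<close>, so the correction
  subtracted from \<open>y\<close> contributes nothing.\<close>

lemma ip_diff_projections:
  assumes "ip_norm ip e = 1"
  shows "ip (x - scale (ip x e) e) (y - scale (ip y e) e) = ip x y - ip x e * ip e y"
  using ip_scale_right_eq_0[OF ip_diff_projection[OF assms]]
  by (simp add: ip_diff_right) (simp add: ip_diff_left ip_scale_left)

lemma norm_ip_diff_le:
  assumes e: "ip_norm ip e = 1" and "A \<noteq> - a" and "B \<noteq> - b"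
    and x: "ip_norm ip (x - scale ((a + A) / 2) e) \<le> 1 / 2 * norm (A - a)"
    and y: "ip_norm ip (y - scale ((b + B) / 2) e) \<le> 1 / 2 * norm (B - b)"
  shows "norm (ip x y - ip x e * ip e y)
       \<le> 1 / 2 * (norm (A - a) * norm (B - b) / sqrt (norm (A + a) * norm (B + b)))
          * sqrt (1 / 8 * ((norm (A - a))\<^sup>2 / norm (A + a)) + norm (ip x e))
          * sqrt (1 / 8 * ((norm (B - b))\<^sup>2 / norm (B + b)) + norm (ip y e))"
    (is "_ \<le> 1 / 2 * (?D * ?E / sqrt (?s * ?t)) * sqrt ?F * sqrt ?G")
proof -
  have "norm (ip x y - ip x e * ip e y)
      \<le> ip_norm ip (x - scale (ip x e) e) * ip_norm ip (y - scale (ip y e) e)"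
    using norm_ip_le by (metis ip_diff_projections[OF e])
  also have "\<dots> \<le> sqrt (1 / 2 * (?D\<^sup>2 / ?s) * ?F) * sqrt (1 / 2 * (?E\<^sup>2 / ?t) * ?G)"
    by (intro mult_mono real_le_rsqrt ip_norm_diff_projection_square_le assms) auto
  \<comment> \<open>Everything is collected under one root with the two factors 1/2 written as a
    square, so that 1/2 and both norms in the numerator come out of the root as absolute
    values.\<close>
  also have "\<dots> = sqrt ((1 / 2)\<^sup>2 * (?D\<^sup>2 * ?E\<^sup>2 / (?s * ?t)) * ?F * ?G)"
    unfolding real_sqrt_mult[symmetric] by (simp add: power2_eq_square mult_ac)
  also have "\<dots> = 1 / 2 * (?D * ?E / sqrt (?s * ?t)) * sqrt ?F * sqrt ?G"
    by (simp only: real_sqrt_mult real_sqrt_divide real_sqrt_abs abs_norm_cancel abs_numeral abs_divide abs_one)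
  finally show ?thesis .
qed

end

theorem theorem6:
  fixes scale :: "'k::real_or_complex \<Rightarrow> 'h::ab_group_add \<Rightarrow> 'h" (infixr "*\<^sub>K" 75)
    and ip :: "'h \<Rightarrow> 'h \<Rightarrow> 'k"
    and x y e :: 'h
    and a A b B :: 'k
  assumes "inner_product_space scale ip"
    and "ip_norm ip e = 1"
    and "A \<noteq> a" and "A \<noteq> - a" and "B \<noteq> b" and "B \<noteq> - b"
  shows
    "((Re (to_complex (ip (A *\<^sub>K e - x) (x - a *\<^sub>K e))) \<ge> 0 \<and>
       Re (to_complex (ip (B *\<^sub>K e - y) (y - b *\<^sub>K e))) \<ge> 0)
      \<longleftrightarrow>
      (ip_norm ip (x - ((a + A) / 2) *\<^sub>K e) \<le> 1 / 2 * norm (A - a) \<and>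
       ip_norm ip (y - ((b + B) / 2) *\<^sub>K e) \<le> 1 / 2 * norm (B - b)))
     \<and>
     ((Re (to_complex (ip (A *\<^sub>K e - x) (x - a *\<^sub>K e))) \<ge> 0 \<and>
       Re (to_complex (ip (B *\<^sub>K e - y) (y - b *\<^sub>K e))) \<ge> 0)
      \<or>
      (ip_norm ip (x - ((a + A) / 2) *\<^sub>K e) \<le> 1 / 2 * norm (A - a) \<and>
       ip_norm ip (y - ((b + B) / 2) *\<^sub>K e) \<le> 1 / 2 * norm (B - b))
      \<longrightarrow>
      norm (ip x y - ip x e * ip e y)
       \<le> 1 / 2 * (norm (A - a) * norm (B - b) / sqrt (norm (A + a) * norm (B + b)))
          * sqrt (1 / 8 * ((norm (A - a))\<^sup>2 / norm (A + a)) + norm (ip x e))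
          * sqrt (1 / 8 * ((norm (B - b))\<^sup>2 / norm (B + b)) + norm (ip y e)))"
proof -
  interpret inner_product_space scale ip
    by fact
  \<comment> \<open>Rewriting the real-part conditions into norm form makes the equivalence trivial
    and merges the two alternatives of the hypothesis.\<close>
  note iff = Re_ip_ge_0_iff_norm_le[OF \<open>ip_norm ip e = 1\<close>]
  show ?thesis
    using norm_ip_diff_le[OF \<open>ip_norm ip e = 1\<close> \<open>A \<noteq> - a\<close> \<open>B \<noteq> - b\<close>]
    unfolding iff by blast
qed

end
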